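(* Let $\Gamma_1,\Gamma_2$ be nonzero real numbers and let $M=\mathbb{CP}^2\times\mathbb{CP}^2$ carry the weighted symplectic form $\Gamma_1\omega_{FS}\oplus\Gamma_2\omega_{FS}$ and the diagonal action of $SU(3)$, with momentum map $J$ as in the context. The momentum polytope $\Delta(M)$ is a line segment in the positive Weyl chamber $\mathfrak{t}^*_+$ with endpoints $a$ and $c$, where $a$ is the value of $\Delta(M)$ given by points $(u,u)\in M$ and $c$ the value given by points $(u,u^\perp)\in M$ with $u,u^\perp$ orthogonal. These segments fall into four different generic types, for which $\Gamma_1\ne\pm\Gamma_2$, and three transitional types, for which $\Gamma_1=\pm\Gamma_2$, as follows. Put $s=\Gamma_1+\Gamma_2$, $\Gamma_+=\max(\Gamma_1,\Gamma_2)$, $\Gamma_-=\min(\Gamma_1,\Gamma_2)$, and $[x_1,x_2,x_3]=(x_1-\tfrac s3,x_2-\tfrac s3,x_3-\tfrac s3)$. Generic types ($a$ lies on a wall of $\mathfrak{t}^*_+$, but is not the origin, and $c$ lies in the interior of $\mathfrak{t}^*_+$): (a) $\Gamma_1,\Gamma_2>0$, $\Gamma_1\neq\Gamma_2$: $a=[s,0,0]$ on the wall $\lambda_2=\lambda_3$, and $c=[\Gamma_+,\Gamma_-,0]$; (b) $\Gamma_+>0>\Gamma_-$, $s>0$: $a=[s,0,0]$ on the wall $\lambda_2=\lambda_3$, and $c=[\Gamma_+,0,\Gamma_-]$; (c) $\Gamma_+>0>\Gamma_-$, $s<0$: $a=[0,0,s]$ on the wall $\lambda_1=\lambda_2$,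 and $c=[\Gamma_+,0,\Gamma_-]$; (d) $\Gamma_1,\Gamma_2<0$, $\Gamma_1\ne\Gamma_2$: $a=[0,0,s]$ on the wall $\lambda_1=\lambda_2$, and $c=[0,\Gamma_+,\Gamma_-]$. Transitional types: (e) $\Gamma_1=\Gamma_2>0$: $a=[s,0,0]$ on the wall $\lambda_2=\lambda_3$, and $c=[\Gamma_1,\Gamma_1,0]$ on the wall $\lambda_1=\lambda_2$; (f) $\Gamma_1+\Gamma_2=0$: $a=(0,0,0)$ and $c=(\Gamma_+,0,\Gamma_-)$, so the segment lies on the line $\lambda_2=0$; (g) $\Gamma_1=\Gamma_2<0$: $a=[0,0,s]$ on the wall $\lambda_1=\lambda_2$, and $c=[0,\Gamma_1,\Gamma_1]$ on the wall $\lambda_2=\lambda_3$.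
   Context: $\omega_{FS}$ is the Fubini–Study symplectic form on $\mathbb{CP}^2$, obtained by reduction of the unit sphere $S^5\subset\mathbb{C}^3$ by $U(1)$. $SU(3)$ acts on $\mathbb{CP}^2$ by $A[v]=[Av]$ and diagonally on products. The dual $\mathfrak{su}(3)^*$ is identified with the trace-zero Hermitian $3\times3$ matrices via the pairing $\langle\mu,\xi\rangle=\operatorname{Im}\operatorname{tr}(\mu\xi)$ with skew-Hermitian $\xi\in\mathfrak{su}(3)$; the coadjoint action is conjugation. The momentum map of $M$ for the weighted symplectic form is $$J(Z_1,Z_2)=\sum_{j=1}^2\Gamma_j\left(Z_j\otimes\overline{Z}_j-\tfrac13 I_3\right),$$ where points of $\mathbb{CP}^2$ are represented by unit vectors and $Z\otimes\overline Z$ is the matrix $(z_i\bar z_j)$. The dual $\mathfrak{t}^*$ of the Cartan subalgebra of diagonal matrices is identified with $\{\lambda\in\mathbb{R}^3:\lambda_1+\lambda_2+\lambda_3=0\}$, and the positive Weyl chamber is $\mathfrak{t}^*_+=\{\lambda_1\ge\lambda_2\ge\lambda_3\}$, with walls $\lambda_1=\lambda_2$ and $\lambda_2=\lambda_3$. The momentum polytope is $\Delta(M)=J(M)\cap\mathfrak{t}^*_+$, equivalently the set of ordered spectra $\lambda_1\ge\lambda_2\ge\lambda_3$ of the matrices in $J(M)$. For a point $m\in M$ "the value of $\Delta(M)$ given by $m$" means the ordered spectrum of $J(m)$. The "type" of a polytope (not formally defined in the paper) refers to its combinatorics together with its position in the Weyl chamber, as described in the list. *)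

theory Defs
  imports "HOL-Analysis.Analysis"
begin

section \<open>The projective plane as the quotient of the unit sphere by \<open>U(1)\<close>\<close>

definition hprod :: "complex^3 \<Rightarrow> complex^3 \<Rightarrow> complex" where
  "hprod u v = (\<Sum>i\<in>UNIV. u $ i * cnj (v $ i))"

definition same_line :: "complex^3 \<Rightarrow> complex^3 \<Rightarrow> bool" where
  "same_line u v \<longleftrightarrow> norm u = 1 \<and> norm v = 1 \<and> (\<exists>c. norm c = 1 \<and> v = c *s u)"

lemma part_equivp_same_line: "part_equivp same_line"
proof (rule part_equivpI)
  have "same_line (axis 1 1) (axis 1 1)"
    unfolding same_line_def by (auto intro!: exI[of _ 1])
  then show "\<exists>x. same_line x x" by blast
  show "symp same_line"
  proof (rule sympI)
    fix u v assume "same_line u v"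
    then obtain c where c: "norm u = 1" "norm v = 1" "norm c = 1" "v = c *s u"
      unfolding same_line_def by blast
    have "c \<noteq> 0" using c by auto
    then have "u = inverse c *s v" using c by (simp add: vec_eq_iff flip: mult.assoc)
    then show "same_line v u" using c unfolding same_line_def
      by (auto simp: norm_inverse intro!: exI[of _ "inverse c"])
  qed
  show "transp same_line"
  proof (rule transpI)
    fix u v w assume "same_line u v" "same_line v w"
    then obtain c d where "norm u = 1" "norm w = 1" "norm c = 1" "norm d = 1"
      "v = c *s u" "w = d *s v"
      unfolding same_line_def by blast
    then show "same_line u w" unfolding same_line_def
      by (auto simp: norm_mult vector_smult_assoc intro!: exI[of _ "d * c"])
  qed
qed

quotient_type cp2 = "complex^3" / partial: same_line
  morphisms rep_cp2 proj_class
  by (rule part_equivp_same_line)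

lemma hprod_scale: "hprod (c *s u) (d *s v) = c * cnj d * hprod u v"
  by (simp add: hprod_def sum_distrib_left algebra_simps)

lift_definition orthogonal_lines :: "cp2 \<Rightarrow> cp2 \<Rightarrow> bool" is "\<lambda>u v. hprod u v = 0"
  by (auto simp: same_line_def hprod_scale)

section \<open>The action of \<open>SU(3)\<close> and the dual of its Lie algebra\<close>

definition ctranspose :: "complex^3^3 \<Rightarrow> complex^3^3" where
  "ctranspose A = (\<chi> i j. cnj (A $ j $ i))"

definition SU3 :: "(complex^3^3) set" where
  "SU3 = {A. A ** ctranspose A = mat 1 \<and> ctranspose A ** A = mat 1 \<and> det A = 1}"

definition su3 :: "(complex^3^3) set" where
  "su3 = {\<xi>. ctranspose \<xi> = - \<xi> \<and> trace \<xi> = 0}"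

definition su3_dual :: "(complex^3^3) set" where
  "su3_dual = {\<mu>. ctranspose \<mu> = \<mu> \<and> trace \<mu> = 0}"

definition su3_pairing :: "complex^3^3 \<Rightarrow> complex^3^3 \<Rightarrow> real" where
  "su3_pairing \<mu> \<xi> = Im (trace (\<mu> ** \<xi>))"

lemma hprod_ctranspose: "hprod (A *v u) v = hprod u (ctranspose A *v v)"
  by (simp add: hprod_def ctranspose_def matrix_vector_mult_def sum_3 algebra_simps)

lemma norm_hprod: "hprod u u = of_real ((norm u)\<^sup>2)"
proof -
  have "(norm u)\<^sup>2 = (\<Sum>i\<in>UNIV. (norm (u $ i))\<^sup>2)"
    by (simp add: norm_vec_def L2_set_def sum_nonneg)
  then show ?thesis by (simp add: hprod_def of_real_sum complex_norm_square del: of_real_power)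
qed

lemma norm_SU3: "A \<in> SU3 \<Longrightarrow> norm (A *v u) = norm u"
proof -
  assume "A \<in> SU3"
  then have "hprod (A *v u) (A *v u) = hprod u u"
    by (simp add: hprod_ctranspose SU3_def matrix_vector_mul_assoc)
  then have "(norm (A *v u))\<^sup>2 = (norm u)\<^sup>2"
    unfolding norm_hprod of_real_eq_iff .
  then show ?thesis by simp
qed

(* The action is only meaningful for matrices in SU3; the other branch makes it total. *)
lift_definition SU3_act :: "complex^3^3 \<Rightarrow> cp2 \<Rightarrow> cp2" is
  "\<lambda>A u. if A \<in> SU3 then A *v u else u"
  by (auto simp: same_line_def norm_SU3 vector_scalar_commute)

definition SU3_act_prod :: "complex^3^3 \<Rightarrow> cp2 \<times> cp2 \<Rightarrow> cp2 \<times> cp2" where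
  "SU3_act_prod A = map_prod (SU3_act A) (SU3_act A)"

section \<open>The momentum map\<close>

definition outer :: "complex^3 \<Rightarrow> complex^3^3" where
  "outer z = (\<chi> i j. z $ i * cnj (z $ j))"

lift_definition cp2_outer :: "cp2 \<Rightarrow> complex^3^3" is outer
proof -
  fix u v assume "same_line u v"
  then obtain c where c: "norm c = 1" "v = c *s u" unfolding same_line_def by blast
  have "c * cnj c = 1" using c(1) by (simp add: complex_norm_square[symmetric])
  then have "c * x * (cnj c * y) = x * y" for x y
    by (metis mult.assoc mult.commute mult.right_neutral)
  then show "outer u = outer v" using c(2) by (simp add: outer_def vec_eq_iff)
qed

definition momentum :: "real \<Rightarrow> real \<Rightarrow> cp2 \<times> cp2 \<Rightarrow> complex^3^3" where
  "momentum \<Gamma>1 \<Gamma>2 = (\<lambda>(p, q).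
     \<Gamma>1 *\<^sub>R (cp2_outer p - (1/3) *\<^sub>R mat 1) + \<Gamma>2 *\<^sub>R (cp2_outer q - (1/3) *\<^sub>R mat 1))"

(* The Fubini-Study form is the form on the quotient whose pullback to the unit sphere is the
   restriction of fs_form.  Its kernel on the tangent space at z is spanned by i z.  The sign and
   the factor 2 are those for which the formula above is a momentum map under the pairing
   su3_pairing. *)
definition fs_form :: "complex^3 \<Rightarrow> complex^3 \<Rightarrow> real" where
  "fs_form v w = 2 * Im (hprod v w)"

definition weighted_form ::
    "real \<Rightarrow> real \<Rightarrow> (complex^3) \<times> (complex^3) \<Rightarrow> (complex^3) \<times> (complex^3) \<Rightarrow> real" where
  "weighted_form \<Gamma>1 \<Gamma>2 v w = \<Gamma>1 * fs_form (fst v) (fst w) + \<Gamma>2 * fs_form (snd v) (snd w)"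

lemma proj_class_outer: "norm z = 1 \<Longrightarrow> cp2_outer (proj_class z) = outer z"
  by (rule cp2_outer.abs_eq) (auto simp: same_line_def intro!: exI[of _ 1])

lemma momentum_in_su3_dual: "momentum \<Gamma>1 \<Gamma>2 m \<in> su3_dual"
proof -
  have *: "ctranspose (cp2_outer p) = cp2_outer p \<and> trace (cp2_outer p) = 1" for p
  proof (transfer)
    fix z assume "same_line z z"
    then have "hprod z z = 1" by (simp add: norm_hprod same_line_def)
    then show "ctranspose (outer z) = outer z \<and> trace (outer z) = 1"
      by (simp add: ctranspose_def outer_def trace_def hprod_def vec_eq_iff)
  qed
  obtain p q where m: "m = (p, q)" by (cases m)
  have adj: "ctranspose (r *\<^sub>R X + t *\<^sub>R Y) = r *\<^sub>R ctranspose X + t *\<^sub>R ctranspose Y"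
    "ctranspose (X - Y) = ctranspose X - ctranspose Y" "ctranspose (r *\<^sub>R X) = r *\<^sub>R ctranspose X"
    "ctranspose (mat 1) = mat 1" for r t X Y
    by (auto simp: ctranspose_def vec_eq_iff mat_def)
  have tr: "trace (r *\<^sub>R X + t *\<^sub>R Y) = r *\<^sub>R trace X + t *\<^sub>R trace Y"
    "trace (X - Y) = trace X - trace Y" "trace (r *\<^sub>R X) = r *\<^sub>R trace X"
    "trace (mat 1 :: complex^3^3) = 3" for r t and X Y :: "complex^3^3"
    by (simp_all add: trace_def sum_3 mat_def scaleR_add_right)
  show ?thesis unfolding m su3_dual_def momentum_def
    by (simp add: adj tr *[of p] *[of q] scaleR_conv_of_real[where 'a=complex])
qed

lemma matrix_linear_simps:
  fixes X Y A :: "complex^3^3"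
  shows "A ** (X + Y) = A ** X + A ** Y" "(X + Y) ** A = X ** A + Y ** A"
    "A ** (X - Y) = A ** X - A ** Y" "(X - Y) ** A = X ** A - Y ** A"
    "A ** (r *\<^sub>R X) = r *\<^sub>R (A ** X)" "(r *\<^sub>R X) ** A = r *\<^sub>R (X ** A)"
  by (simp_all add: matrix_matrix_mult_def vec_eq_iff sum.distrib sum_subtractf scaleR_sum_right
      algebra_simps)

lemma momentum_equivariant:
  assumes "A \<in> SU3"
  shows "momentum \<Gamma>1 \<Gamma>2 (SU3_act_prod A m) = A ** momentum \<Gamma>1 \<Gamma>2 m ** ctranspose A"
proof -
  have *: "cp2_outer (SU3_act A p) = A ** cp2_outer p ** ctranspose A" for p
    using assms
  proof transfer
    fix A z
    have "outer (A *v z) = A ** outer z ** ctranspose A"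
      by (simp add: outer_def ctranspose_def matrix_vector_mult_def matrix_matrix_mult_def
          vec_eq_iff sum_3 algebra_simps)
    then show "A \<in> SU3 \<Longrightarrow> outer (if A \<in> SU3 then A *v z else z) = A ** outer z ** ctranspose A"
      by simp
  qed
  have U: "A ** ctranspose A = mat 1" using assms by (simp add: SU3_def)
  have lin: "A ** (r *\<^sub>R (X - (1/3) *\<^sub>R mat 1) + t *\<^sub>R (Y - (1/3) *\<^sub>R mat 1)) ** B =
    r *\<^sub>R (A ** X ** B - (1/3) *\<^sub>R (A ** B)) + t *\<^sub>R (A ** Y ** B - (1/3) *\<^sub>R (A ** B))"
    for r t :: real and X Y B :: "complex^3^3"
    by (simp add: matrix_linear_simps)
  show ?thesis by (cases m) (simp add: momentum_def SU3_act_prod_def * lin U)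
qed

lemma bounded_bilinear_hprod: "bounded_bilinear hprod"
  unfolding bilinear_conv_bounded_bilinear[symmetric] bilinear_def
  by (auto intro!: linearI simp: hprod_def sum_3 scaleR_conv_of_real[where 'a=complex]) (simp_all add: algebra_simps)

lemma hprod_cnj: "hprod v u = cnj (hprod u v)"
  by (simp add: hprod_def algebra_simps)

(* Hamilton's equation d <J, xi> = omega (xi_M, -), pulled back to the product of unit spheres. *)
lemma momentum_hamiltonian:
  fixes z1 z2 :: "complex^3"
  assumes xi: "\<xi> \<in> su3" and z: "norm z1 = 1" "norm z2 = 1"
  shows "((\<lambda>z. su3_pairing (momentum \<Gamma>1 \<Gamma>2 (proj_class (fst z), proj_class (snd z))) \<xi>)
    has_derivative weighted_form \<Gamma>1 \<Gamma>2 (\<xi> *v z1, \<xi> *v z2))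
    (at (z1, z2) within sphere 0 1 \<times> sphere 0 1)"
proof -
  define g where "g = (\<lambda>z. \<Gamma>1 * Im (hprod (\<xi> *v fst z) (fst z)) + \<Gamma>2 * Im (hprod (\<xi> *v snd z) (snd z)))"
  have tr: "\<xi>$1$1 + \<xi>$2$2 + \<xi>$3$3 = 0" using xi by (simp add: su3_def trace_def sum_3)
  have pair: "su3_pairing (r *\<^sub>R (outer u - (1/3) *\<^sub>R mat 1) + t *\<^sub>R (outer v - (1/3) *\<^sub>R mat 1)) \<xi>
      = r * Im (hprod (\<xi> *v u) u) + t * Im (hprod (\<xi> *v v) v)" for r t u v
  proof -
    have "trace ((r *\<^sub>R (outer u - (1/3) *\<^sub>R mat 1) + t *\<^sub>R (outer v - (1/3) *\<^sub>R mat 1)) ** \<xi>)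
       = of_real r * hprod (\<xi> *v u) u + of_real t * hprod (\<xi> *v v) v
         - of_real ((r + t) / 3) * (\<xi>$1$1 + \<xi>$2$2 + \<xi>$3$3)"
      by (simp add: trace_def outer_def mat_def hprod_def matrix_matrix_mult_def
          matrix_vector_mult_def sum_3 scaleR_conv_of_real[where 'a=complex])
        (simp add: field_simps)
    then show ?thesis by (simp add: su3_pairing_def tr)
  qed
  have lin: "bounded_linear ((*v) \<xi>)"
    by (rule linear_conv_bounded_linear[THEN iffD1])
      (auto intro!: linearI simp: matrix_vector_mult_def vec_eq_iff sum_3 scaleR_conv_of_real[where 'a=complex] algebra_simps)
  have skew: "Im (hprod (\<xi> *v v) u) = Im (hprod (\<xi> *v u) v)" for u v
  proof -
    have "hprod (\<xi> *v v) u = hprod v ((- \<xi>) *v u)"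
      using xi by (simp add: hprod_ctranspose su3_def)
    also have "\<dots> = - cnj (hprod (\<xi> *v u) v)"
      by (simp add: hprod_def matrix_vector_mult_def sum_3 algebra_simps)
    finally show ?thesis by simp
  qed
  note fd = bounded_bilinear.FDERIV[OF bounded_bilinear_hprod]
    bounded_linear.has_derivative[OF lin] bounded_linear.has_derivative[OF bounded_linear_Im]
  have fst: "((\<lambda>z. Im (hprod (\<xi> *v fst z) (fst z))) has_derivative
      (\<lambda>w. Im (hprod (\<xi> *v z1) (fst w) + hprod (\<xi> *v fst w) z1))) (at (z1, z2) within S)" for S
    by (rule fd(3), rule fd(1)[THEN has_derivative_eq_rhs]) (auto intro!: fd(2) derivative_intros)
  have snd: "((\<lambda>z. Im (hprod (\<xi> *v snd z) (snd z))) has_derivative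
      (\<lambda>w. Im (hprod (\<xi> *v z2) (snd w) + hprod (\<xi> *v snd w) z2))) (at (z1, z2) within S)" for S
    by (rule fd(3), rule fd(1)[THEN has_derivative_eq_rhs]) (auto intro!: fd(2) derivative_intros)
  have "(g has_derivative weighted_form \<Gamma>1 \<Gamma>2 (\<xi> *v z1, \<xi> *v z2)) (at (z1, z2) within S)" for S
    unfolding g_def
    by (rule has_derivative_eq_rhs[OF has_derivative_add[OF has_derivative_mult_right[OF fst]
            has_derivative_mult_right[OF snd]]])
      (auto simp: weighted_form_def fs_form_def skew fun_eq_iff)
  then show ?thesis
    by (rule has_derivative_transform[rotated 2])
      (use z in \<open>auto simp: g_def momentum_def proj_class_outer pair\<close>)
qed

section \<open>The positive Weyl chamber and the momentum polytope\<close>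

definition cartan_dual :: "(real^3) set" where
  "cartan_dual = {x. x$1 + x$2 + x$3 = 0}"

(* cartan_dual stands for the diagonal matrices in su3_dual, through diag_mat below. *)
definition weyl_chamber :: "(real^3) set" where
  "weyl_chamber = {x \<in> cartan_dual. x$1 \<ge> x$2 \<and> x$2 \<ge> x$3}"

definition weyl_interior :: "(real^3) set" where
  "weyl_interior = top_of_set cartan_dual interior_of weyl_chamber"

definition wall12 :: "(real^3) set" where
  "wall12 = {x \<in> weyl_chamber. x$1 = x$2}"

definition wall23 :: "(real^3) set" where
  "wall23 = {x \<in> weyl_chamber. x$2 = x$3}"

definition diag_mat :: "real^3 \<Rightarrow> complex^3^3" where
  "diag_mat x = (\<chi> i j. if i = j then of_real (x $ i) else 0)"

definition momentum_polytope :: "real \<Rightarrow> real \<Rightarrow> (real^3) set" where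
  "momentum_polytope \<Gamma>1 \<Gamma>2 = {x \<in> weyl_chamber. diag_mat x \<in> range (momentum \<Gamma>1 \<Gamma>2)}"

(* Eigenvalues with multiplicity, as roots of the characteristic polynomial. *)
definition ordered_spectrum :: "complex^3^3 \<Rightarrow> real^3 \<Rightarrow> bool" where
  "ordered_spectrum A x \<longleftrightarrow> x$1 \<ge> x$2 \<and> x$2 \<ge> x$3 \<and>
     (\<forall>t. det (mat t - A) = (\<Prod>i\<in>UNIV. t - of_real (x $ i)))"

definition shifted :: "real \<Rightarrow> real \<Rightarrow> real \<Rightarrow> real \<Rightarrow> real^3" where
  "shifted s x1 x2 x3 = vector [x1 - s/3, x2 - s/3, x3 - s/3]"

section \<open>The types\<close>

datatype polytope_type = Type_a | Type_b | Type_c | Type_d | Type_e | Type_f | Type_g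

definition generic_types :: "polytope_type set" where
  "generic_types = {Type_a, Type_b, Type_c, Type_d}"

definition transitional_types :: "polytope_type set" where
  "transitional_types = {Type_e, Type_f, Type_g}"

(* of_type classifies the pair of weights (taken to be nonzero), not the polytope; that polytopes
   of different types differ is part of the theorem. *)
fun of_type :: "polytope_type \<Rightarrow> real \<Rightarrow> real \<Rightarrow> bool" where
  "of_type Type_a \<Gamma>1 \<Gamma>2 \<longleftrightarrow> \<Gamma>1 > 0 \<and> \<Gamma>2 > 0 \<and> \<Gamma>1 \<noteq> \<Gamma>2"
| "of_type Type_b \<Gamma>1 \<Gamma>2 \<longleftrightarrow> max \<Gamma>1 \<Gamma>2 > 0 \<and> 0 > min \<Gamma>1 \<Gamma>2 \<and> \<Gamma>1 + \<Gamma>2 > 0"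
| "of_type Type_c \<Gamma>1 \<Gamma>2 \<longleftrightarrow> max \<Gamma>1 \<Gamma>2 > 0 \<and> 0 > min \<Gamma>1 \<Gamma>2 \<and> \<Gamma>1 + \<Gamma>2 < 0"
| "of_type Type_d \<Gamma>1 \<Gamma>2 \<longleftrightarrow> \<Gamma>1 < 0 \<and> \<Gamma>2 < 0 \<and> \<Gamma>1 \<noteq> \<Gamma>2"
| "of_type Type_e \<Gamma>1 \<Gamma>2 \<longleftrightarrow> \<Gamma>1 = \<Gamma>2 \<and> \<Gamma>1 > 0"
| "of_type Type_f \<Gamma>1 \<Gamma>2 \<longleftrightarrow> \<Gamma>1 + \<Gamma>2 = 0"
| "of_type Type_g \<Gamma>1 \<Gamma>2 \<longleftrightarrow> \<Gamma>1 = \<Gamma>2 \<and> \<Gamma>1 < 0"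

end

theory Submission
  imports Defs
begin

text \<open>
  The matrix \<open>J + (s/3) I\<close> is a combination of two rank-one projections, so one of its eigenvalues
  is \<open>0\<close>, and the other two have sum \<open>s\<close> and product \<open>\<Gamma>\<^sub>1 \<Gamma>\<^sub>2 r\<close> with
  \<open>r = 1 - |\<langle>u, v\<rangle>|\<^sup>2\<close>, which ranges over \<open>[0, 1]\<close>.  The value \<open>r = 0\<close> gives the endpoint
  \<open>a\<close> and \<open>r = 1\<close> the endpoint \<open>c\<close>.  Which of the ordered eigenvalues vanishes depends only on the
  signs of the weights, so the ordered spectra form a segment.
  Conversely every admissible spectrum is attained by real vectors in a coordinate plane: fix the
  angle between them and rotate both until the off-diagonal entry of \<open>J\<close> vanishes.
\<close>

section \<open>Characteristic polynomial of the momentum matrix\<close>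

text \<open>Two rank-one terms in dimension three leave a kernel, hence the factor
  \<open>\<tau>\<close>. The constant term of the other factor is \<open>g * h\<close> times the
  Gram determinant of \<open>u\<close> and \<open>v\<close>.\<close>

lemma det_rank_two:
  fixes u v :: "complex^3" and \<tau> :: complex and g h :: real
  shows "det (mat \<tau> - (g *\<^sub>R outer u + h *\<^sub>R outer v)) =
    \<tau> * (\<tau>\<^sup>2 - (g * hprod u u + h * hprod v v) * \<tau> +
      g * h * (hprod u u * hprod v v - hprod u v * hprod v u))"
  unfolding det_3 hprod_def sum_3 outer_def
  by (simp add: mat_def scaleR_conv_of_real[where 'a=complex]) algebra

lemma prod_UNIV_3: "prod f (UNIV :: 3 set) = f 1 * f 2 * f 3"
  for f :: "3 \<Rightarrow> 'a :: comm_monoid_mult"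
  unfolding UNIV_3 by (simp add: ac_simps)

text \<open>\<open>same_line\<close> is reflexive only on the unit sphere, so the chosen
  representative is automatically a unit vector.\<close>

lemma cp2_cases:
  obtains u where "norm u = 1" "p = proj_class u"
proof -
  have "same_line (rep_cp2 p) (rep_cp2 p)"
    using Quotient_rep_reflp[OF Quotient_cp2] .
  moreover have "p = proj_class (rep_cp2 p)"
    using Quotient_abs_rep[OF Quotient_cp2] by metis
  ultimately show ?thesis using that by (auto simp: same_line_def)
qed

lemma momentum_proj_class:
  assumes "norm u = 1" "norm v = 1"
  shows "momentum \<Gamma>1 \<Gamma>2 (proj_class u, proj_class v) =
    \<Gamma>1 *\<^sub>R outer u + \<Gamma>2 *\<^sub>R outer v - ((\<Gamma>1 + \<Gamma>2) / 3) *\<^sub>R mat 1"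
  using assms by (simp add: momentum_def proj_class_outer algebra_simps add_divide_distrib)

text \<open>Passing from \<open>t\<close> to \<open>\<tau>\<close> absorbs the trace correction and
  leaves the rank-two combination. For unit vectors the Gram determinant is the squared sine of the
  angle between the lines.\<close>

lemma det_momentum:
  fixes t \<tau> :: complex
  assumes "norm u = 1" "norm v = 1" "\<tau> = t + of_real ((\<Gamma>1 + \<Gamma>2) / 3)"
  shows "det (mat t - momentum \<Gamma>1 \<Gamma>2 (proj_class u, proj_class v)) =
    \<tau> * (\<tau>\<^sup>2 - (\<Gamma>1 + \<Gamma>2) * \<tau> + \<Gamma>1 * \<Gamma>2 * (1 - (norm (hprod u v))\<^sup>2))"
proof -
  have "mat t - momentum \<Gamma>1 \<Gamma>2 (proj_class u, proj_class v) =
      mat \<tau> - (\<Gamma>1 *\<^sub>R outer u + \<Gamma>2 *\<^sub>R outer v)"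
    unfolding momentum_proj_class[OF assms(1,2)] assms(3)
    by (simp add: vec_eq_iff mat_def scaleR_conv_of_real[where 'a=complex])
  moreover have "hprod u v * hprod v u = of_real ((norm (hprod u v))\<^sup>2)"
    unfolding hprod_cnj[of v u] by (rule complex_norm_square[symmetric])
  ultimately show ?thesis
    using assms(1,2) by (simp add: det_rank_two norm_hprod)
qed

lemma orthogonal_lines_proj_class:
  assumes "norm u = 1" "norm v = 1"
  shows "orthogonal_lines (proj_class u) (proj_class v) \<longleftrightarrow> hprod u v = 0"
  by (rule orthogonal_lines.abs_eq) (use assms in \<open>auto simp: same_line_def intro!: exI[of _ 1]\<close>)

text \<open>Cauchy-Schwarz, reduced to the real inequality for the moduli of the entries. It keeps
  the Gram determinant of unit vectors nonnegative.\<close>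

lemma norm_hprod_le: "norm (hprod u v) \<le> norm u * norm v"
proof -
  have "norm (hprod u v) \<le> (\<Sum>i\<in>UNIV. \<bar>norm (u $ i)\<bar> * \<bar>norm (v $ i)\<bar>)"
    unfolding hprod_def by (rule order_trans[OF norm_sum]) (simp add: norm_mult)
  also have "\<dots> \<le> norm u * norm v"
    unfolding norm_vec_def by (rule L2_set_mult_ineq)
  finally show ?thesis .
qed

section \<open>Realising spectra by real vectors in a coordinate plane\<close>

text \<open>The symmetric 2x2 matrix built from unit vectors at angles \<open>\<alpha>\<close> and
  \<open>\<beta>\<close> with weights \<open>g\<close> and \<open>h\<close> has trace
  \<open>g + h\<close>, and determinant \<open>g * h * r\<close> once the squared sine of the angle
  between them is \<open>r\<close>. When it is diagonal, its entries are the two roots of the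
  quadratic satisfied by \<open>y\<close>.\<close>

lemma diagonal_combination_exists:
  fixes g h y r :: real
  assumes "y * (g + h - y) = g * h * r" "0 \<le> r" "r \<le> 1"
  obtains \<alpha> \<beta> where "g * (cos \<alpha>)\<^sup>2 + h * (cos \<beta>)\<^sup>2 = y"
    "g * (cos \<alpha> * sin \<alpha>) + h * (cos \<beta> * sin \<beta>) = 0"
proof -
  define \<theta> where "\<theta> = arcsin (sqrt r)"
  have sin\<theta>: "(sin \<theta>)\<^sup>2 = r"
  proof -
    have "-1 \<le> sqrt r" by (rule order_trans[of _ 0]) (use assms in auto)
    then show ?thesis using assms by (simp add: \<theta>_def)
  qed
  \<comment> \<open>The off-diagonal entry after rotating the pair by \<open>\<phi>\<close> with its
    angle \<open>\<theta>\<close> kept fixed.\<close>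
  define f where "f \<phi> = g * (cos \<phi> * sin \<phi>) + h * (cos (\<phi> + \<theta>) * sin (\<phi> + \<theta>))" for \<phi>
  \<comment> \<open>A quarter turn negates the off-diagonal entry, so it vanishes somewhere in
    between.\<close>
  have end_val: "f (pi / 2) = - f 0"
    by (simp add: f_def cos_add sin_add)
  have cont: "continuous_on S f" for S
    unfolding f_def by (intro continuous_intros)
  obtain \<phi> where \<phi>: "f \<phi> = 0"
  proof (cases "f 0 \<le> 0")
    case True
    then show ?thesis
      using IVT'[of f 0 0 "pi/2"] end_val cont pi_gt_zero that by auto
  next
    case False
    then show ?thesis
      using IVT2'[of f "pi/2" 0 0] end_val cont pi_gt_zero that by auto
  qed
  define z where "z = g * (cos \<phi>)\<^sup>2 + h * (cos (\<phi> + \<theta>))\<^sup>2"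
  define w where "w = g * (sin \<phi>)\<^sup>2 + h * (sin (\<phi> + \<theta>))\<^sup>2"
  have sum: "w = g + h - z"
    unfolding w_def z_def by (simp add: sin_squared_eq algebra_simps)
  \<comment> \<open>The determinant depends only on the angle between the two vectors, not on
    \<open>\<phi>\<close>.\<close>
  have det: "z * w - (f \<phi>)\<^sup>2 = g * h * (sin (\<phi> + \<theta>) * cos \<phi> - cos (\<phi> + \<theta>) * sin \<phi>)\<^sup>2"
    unfolding z_def w_def f_def by algebra
  have "z * w = g * h * r"
    using det by (simp add: \<phi> sin\<theta> flip: sin_diff)
  \<comment> \<open>Both \<open>y\<close> and \<open>z\<close> are roots of the quadratic with root
    sum \<open>g + h\<close> and root product \<open>g * h * r\<close>.\<close>
  then have "(z - y) * (z - (g + h - y)) = 0"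
    using assms(1) unfolding sum by (simp add: algebra_simps)
  then consider "z = y" | "w = y" using sum by force
  then show ?thesis
  proof cases
    case 1
    with \<phi> show ?thesis unfolding z_def f_def by (rule that[rotated])
  next
    case 2
    \<comment> \<open>Here \<open>y\<close> is the second diagonal entry; one more quarter turn
      exchanges the two entries and keeps the matrix diagonal.\<close>
    have rot: "cos (\<psi> + pi / 2) = - sin \<psi>" "sin (\<psi> + pi / 2) = cos \<psi>" for \<psi> :: real
      by (simp_all add: cos_add sin_add)
    show ?thesis
    proof (rule that)
      show "g * (cos (\<phi> + pi/2))\<^sup>2 + h * (cos (\<phi> + \<theta> + pi/2))\<^sup>2 = y"
        using 2 by (simp add: w_def rot)
      show "g * (cos (\<phi> + pi/2) * sin (\<phi> + pi/2)) +
          h * (cos (\<phi> + \<theta> + pi/2) * sin (\<phi> + \<theta> + pi/2)) = 0"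
        using \<phi> unfolding f_def rot by algebra
    qed
  qed
qed

definition plane_vec :: "3 \<Rightarrow> 3 \<Rightarrow> real \<Rightarrow> complex^3" where
  "plane_vec i j \<alpha> = (\<chi> k. if k = i then of_real (cos \<alpha>) else if k = j then of_real (sin \<alpha>) else 0)"

lemma norm_plane_vec:
  assumes "i \<noteq> j"
  shows "norm (plane_vec i j \<alpha>) = 1"
proof -
  have "hprod (plane_vec i j \<alpha>) (plane_vec i j \<alpha>) =
      (\<Sum>k\<in>UNIV. (if k = i then of_real ((cos \<alpha>)\<^sup>2) else 0) + (if k = j then of_real ((sin \<alpha>)\<^sup>2) else 0))"
    unfolding hprod_def by (rule sum.cong) (use assms in \<open>auto simp: plane_vec_def power2_eq_square\<close>)
  also have "\<dots> = 1"
    by (simp add: sum.distrib flip: of_real_add of_real_power)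
  finally show ?thesis
    unfolding norm_hprod of_real_eq_1_iff using norm_ge_zero power2_eq_imp_eq[of _ "1::real"] by simp
qed

text \<open>The indices stay arbitrary because the zero eigenvalue may sit in any of the three
  positions. Only \<open>y $ i\<close> is prescribed when choosing the angles; the trace then fixes
  \<open>y $ j\<close>.\<close>

lemma diag_mat_in_range_momentum:
  assumes "i \<noteq> j" "0 \<le> r" "r \<le> 1"
    and y: "y $ i + y $ j = \<Gamma>1 + \<Gamma>2" "y $ i * y $ j = \<Gamma>1 * \<Gamma>2 * r"
      "\<And>k. k \<noteq> i \<Longrightarrow> k \<noteq> j \<Longrightarrow> y $ k = 0"
  shows "diag_mat (\<chi> k. y $ k - (\<Gamma>1 + \<Gamma>2) / 3) \<in> range (momentum \<Gamma>1 \<Gamma>2)"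
proof -
  have "y $ i * (\<Gamma>1 + \<Gamma>2 - y $ i) = \<Gamma>1 * \<Gamma>2 * r"
    using y(1,2) by (simp add: algebra_simps flip: y(1))
  then obtain \<alpha> \<beta> where ab: "\<Gamma>1 * (cos \<alpha>)\<^sup>2 + \<Gamma>2 * (cos \<beta>)\<^sup>2 = y $ i"
    "\<Gamma>1 * (cos \<alpha> * sin \<alpha>) + \<Gamma>2 * (cos \<beta> * sin \<beta>) = 0"
    using diagonal_combination_exists assms(2,3) by metis
  have ab': "\<Gamma>1 * (sin \<alpha>)\<^sup>2 + \<Gamma>2 * (sin \<beta>)\<^sup>2 = y $ j"
    using ab(1) y(1) by (simp add: sin_squared_eq algebra_simps)
  have off: "\<Gamma>1 * (complex_of_real (cos \<alpha>) * complex_of_real (sin \<alpha>)) +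
      \<Gamma>2 * (complex_of_real (cos \<beta>) * complex_of_real (sin \<beta>)) = 0"
    using arg_cong[OF ab(2), of complex_of_real] by simp
  have "\<Gamma>1 *\<^sub>R outer (plane_vec i j \<alpha>) + \<Gamma>2 *\<^sub>R outer (plane_vec i j \<beta>) = diag_mat y"
    using off \<open>i \<noteq> j\<close> y(3)
    by (auto simp: vec_eq_iff outer_def plane_vec_def diag_mat_def scaleR_conv_of_real[where 'a=complex]
        mult.commute power2_eq_square simp flip: ab(1) ab')
  then have "momentum \<Gamma>1 \<Gamma>2 (proj_class (plane_vec i j \<alpha>), proj_class (plane_vec i j \<beta>)) =
      diag_mat (\<chi> k. y $ k - (\<Gamma>1 + \<Gamma>2) / 3)"
    using \<open>i \<noteq> j\<close> by (simp add: momentum_proj_class norm_plane_vec)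
      (simp add: diag_mat_def vec_eq_iff mat_def scaleR_conv_of_real[where 'a=complex])
  then show ?thesis by (metis rangeI)
qed

section \<open>The polytope in terms of elementary symmetric functions\<close>

lemma det_mat_minus_diag_mat:
  "det (mat t - diag_mat x) = (\<Prod>i\<in>UNIV. t - of_real (x $ i))"
  by (subst det_diagonal) (auto simp: mat_def diag_mat_def)

text \<open>The values at 0, 1 and -1 already determine the three lower coefficients.\<close>

lemma cubic_coeffs_unique:
  fixes a b c a' b' c' :: complex
  assumes eq: "\<And>t::complex. t^3 + a * t\<^sup>2 + b * t + c = t^3 + a' * t\<^sup>2 + b' * t + c'"
  shows "a = a'" "b = b'" "c = c'"
proof -
  show "c = c'" using eq[of 0] by simp
  then have "a + b = a' + b'" "a - b = a' - b'"
    using eq[of 1] eq[of "-1"] by simp_all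
  then show "a = a'" "b = b'" by algebra+
qed

text \<open>The entries of \<open>y\<close> are the eigenvalues of the rank-two combination. One
  direction compares characteristic polynomials. For the other, the vanishing product makes one
  entry zero, and the remaining two are realised in the corresponding coordinate plane.\<close>

lemma momentum_polytope_iff:
  assumes y: "\<And>k. y $ k = x $ k + (\<Gamma>1 + \<Gamma>2) / 3"
  shows "x \<in> momentum_polytope \<Gamma>1 \<Gamma>2 \<longleftrightarrow>
    y $ 1 \<ge> y $ 2 \<and> y $ 2 \<ge> y $ 3 \<and> y $ 1 + y $ 2 + y $ 3 = \<Gamma>1 + \<Gamma>2 \<and> y $ 1 * y $ 2 * y $ 3 = 0 \<and>
    (\<exists>r. 0 \<le> r \<and> r \<le> 1 \<and> y $ 1 * y $ 2 + y $ 1 * y $ 3 + y $ 2 * y $ 3 = \<Gamma>1 * \<Gamma>2 * r)"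
    (is "?L \<longleftrightarrow> ?R")
proof
  assume ?L
  then obtain p q where pq: "x \<in> weyl_chamber" "diag_mat x = momentum \<Gamma>1 \<Gamma>2 (p, q)"
    by (auto simp: momentum_polytope_def)
  obtain u v where uv: "norm u = 1" "p = proj_class u" "norm v = 1" "q = proj_class v"
    using cp2_cases by metis
  define r where "r = 1 - (norm (hprod u v))\<^sup>2"
  have r: "0 \<le> r" "r \<le> 1"
    using norm_hprod_le[of u v] uv by (auto simp: r_def power_le_one)
  have "\<tau>^3 + of_real (- (y$1 + y$2 + y$3)) * \<tau>\<^sup>2 + of_real (y$1 * y$2 + y$1 * y$3 + y$2 * y$3) * \<tau>
        + of_real (- (y$1 * y$2 * y$3)) =
      \<tau>^3 + of_real (- (\<Gamma>1 + \<Gamma>2)) * \<tau>\<^sup>2 + of_real (\<Gamma>1 * \<Gamma>2 * r) * \<tau> + 0" for \<tau> :: complex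
  proof -
    have "(\<Prod>k\<in>UNIV. \<tau> - of_real (y $ k)) =
        \<tau> * (\<tau>\<^sup>2 - (\<Gamma>1 + \<Gamma>2) * \<tau> + \<Gamma>1 * \<Gamma>2 * r)"
      using det_momentum[OF uv(1,3), where \<tau> = \<tau> and t = "\<tau> - of_real ((\<Gamma>1 + \<Gamma>2) / 3)" and ?\<Gamma>1.0 = \<Gamma>1 and ?\<Gamma>2.0 = \<Gamma>2]
      unfolding uv(2,4)[symmetric] pq(2)[symmetric] det_mat_minus_diag_mat
      by (simp add: y r_def algebra_simps)
    then show ?thesis
      unfolding prod_UNIV_3 of_real_minus of_real_add of_real_mult by algebra
  qed
  note * = cubic_coeffs_unique[OF this]
  have "y $ 1 + y $ 2 + y $ 3 = \<Gamma>1 + \<Gamma>2"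
    "y$1 * y$2 + y$1 * y$3 + y$2 * y$3 = \<Gamma>1 * \<Gamma>2 * r" "y $ 1 * y $ 2 * y $ 3 = 0"
    using *(1) *(2) *(3) unfolding of_real_eq_iff of_real_eq_0_iff by simp_all
  with r pq(1) show ?R by (auto simp: weyl_chamber_def y)
next
  assume R: ?R
  then obtain r where r: "0 \<le> r" "r \<le> 1"
    "y $ 1 * y $ 2 + y $ 1 * y $ 3 + y $ 2 * y $ 3 = \<Gamma>1 * \<Gamma>2 * r" by blast
  have x: "x = (\<chi> k. y $ k - (\<Gamma>1 + \<Gamma>2) / 3)" by (simp add: vec_eq_iff y)
  have "diag_mat x \<in> range (momentum \<Gamma>1 \<Gamma>2)"
  proof -
    consider "y $ 3 = 0" | "y $ 2 = 0" | "y $ 1 = 0" using R by auto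
    then show ?thesis
    proof cases
      case 1
      moreover have "y $ k = 0" if "k \<noteq> 1" "k \<noteq> 2" for k
        using 1 that exhaust_3 by metis
      ultimately show ?thesis unfolding x
        using R r by (intro diag_mat_in_range_momentum[of 1 2 r]) simp_all
    next
      case 2
      moreover have "y $ k = 0" if "k \<noteq> 1" "k \<noteq> 3" for k
        using 2 that exhaust_3 by metis
      ultimately show ?thesis unfolding x
        using R r by (intro diag_mat_in_range_momentum[of 1 3 r]) simp_all
    next
      case 3
      moreover have "y $ k = 0" if "k \<noteq> 2" "k \<noteq> 3" for k
        using 3 that exhaust_3 by metis
      ultimately show ?thesis unfolding x
        using R r by (intro diag_mat_in_range_momentum[of 2 3 r]) simp_all
    qed
  qed
  moreover have "y $ 1 + y $ 2 + y $ 3 = \<Gamma>1 + \<Gamma>2" using R by blast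
  then have "x $ 1 + x $ 2 + x $ 3 = 0" unfolding y by argo
  ultimately show ?L
    using R by (simp add: momentum_polytope_def weyl_chamber_def cartan_dual_def y)
qed

section \<open>From symmetric functions to a segment\<close>

text \<open>
  The maxima and minima sort the triples \<open>(s, 0, 0)\<close> and \<open>(\<Gamma>1, \<Gamma>2, 0)\<close> for all signs of the weights
  at once.
\<close>

definition polytope_a :: "real \<Rightarrow> real \<Rightarrow> real^3" where
  "polytope_a \<Gamma>1 \<Gamma>2 = (let s = \<Gamma>1 + \<Gamma>2 in shifted s (max s 0) 0 (min s 0))"

definition polytope_c :: "real \<Rightarrow> real \<Rightarrow> real^3" where
  "polytope_c \<Gamma>1 \<Gamma>2 = (let p = max \<Gamma>1 \<Gamma>2; m = min \<Gamma>1 \<Gamma>2 in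
     shifted (\<Gamma>1 + \<Gamma>2) (max p 0) (max m 0 + min p 0) (min m 0))"

text \<open>Here \<open>p\<close> and \<open>m\<close> are the larger and the smaller weight. Their
  signs decide which coordinate vanishes; the other two have a fixed sum, and the bounds on their
  product cut out a segment. The parameter \<open>t\<close> divides by a weight of smallest modulus:
  the coordinate in its position runs from 0 at one endpoint to that weight at the other.\<close>

lemma segment_coordinates_iff:
  fixes p m y1 y2 y3 :: real
  assumes "m \<le> p" "p \<noteq> 0" "m \<noteq> 0" and s: "s = p + m"
  shows "(y1 \<ge> y2 \<and> y2 \<ge> y3 \<and> y1 + y2 + y3 = s \<and> y1 * y2 * y3 = 0 \<and>
      (\<exists>r. 0 \<le> r \<and> r \<le> 1 \<and> y1 * y2 + y1 * y3 + y2 * y3 = p * m * r)) \<longleftrightarrow>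
    (\<exists>t. 0 \<le> t \<and> t \<le> 1 \<and> y1 = (1 - t) * max s 0 + t * max p 0 \<and>
      y2 = t * (max m 0 + min p 0) \<and> y3 = (1 - t) * min s 0 + t * min m 0)"
    (is "?L \<longleftrightarrow> ?R")
proof
  assume ?L
  then obtain r where y: "y1 \<ge> y2" "y2 \<ge> y3" "y1 + y2 + y3 = s" "y1 * y2 * y3 = 0"
    and r: "0 \<le> r" "r \<le> 1" "y1 * y2 + y1 * y3 + y2 * y3 = p * m * r" by blast
  \<comment> \<open>Points of the line with sum \<open>s\<close>, interpolated between
    \<open>(s, 0)\<close> and \<open>(k, g)\<close>; the parameter is \<open>w / g\<close>.\<close>
  have conv: "z = (1 - w / g) * s + (w / g) * k" if "z + w = s" "g + k = s" "g \<noteq> 0" for w z g k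
  proof -
    have "z = s - (w / g) * g" using that by simp
    also have "\<dots> = (1 - w / g) * s + (w / g) * k"
      unfolding that(2)[symmetric] by (simp add: left_diff_distrib distrib_left)
    finally show ?thesis .
  qed
  consider "m > 0" | "p > 0" "m < 0" | "p < 0" using assms by linarith
  then show ?R
  proof cases
    case 1
    have e2: "0 \<le> p * m * r" "p * m * r \<le> p * m" using 1 assms r by (auto intro: mult_left_le)
    \<comment> \<open>Otherwise the zero is \<open>y1\<close>, making the sum nonpositive although
      \<open>s\<close> is positive, or \<open>y2\<close>, making the product of the outer two
      negative although it is \<open>p * m * r\<close>.\<close>
    have "y3 = 0"
    proof (rule ccontr)
      assume "y3 \<noteq> 0"
      then consider "y1 = 0" | "y2 = 0" using y by auto
      then show False
      proof cases
        case 1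
        then show False using y s \<open>m > 0\<close> assms by linarith
      next
        case 2
        then have "y3 < 0" using y \<open>y3 \<noteq> 0\<close> by linarith
        moreover have "y1 > 0" using y 2 s \<open>m > 0\<close> assms by linarith
        ultimately have "y1 * y3 < 0" by (simp add: mult_pos_neg)
        then show False using 2 r(3) e2 by simp
      qed
    qed
    then have e: "y1 * y2 = p * m * r" "y1 + y2 = p + m" using r(3) y s by auto
    have "0 \<le> y2"
    proof (rule ccontr)
      assume "\<not> 0 \<le> y2"
      then have "y1 * y2 < 0" using e(2) 1 assms by (intro mult_pos_neg) linarith+
      then show False using e e2 by simp
    qed
    moreover have "y2 \<le> m"
    proof (rule ccontr)
      assume "\<not> y2 \<le> m"
      \<comment> \<open>Since \<open>y1\<close> is at least \<open>y2\<close>, both factors are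
        positive, whereas the expansion equals \<open>p * m * (r - 1)\<close>.\<close>
      then have "(y2 - m) * (y1 - m) > 0" using y(1) by (intro mult_pos_pos) linarith+
      moreover have "(y2 - m) * (y1 - m) = y1 * y2 - m * (y1 + y2) + m * m"
        by (simp add: algebra_simps)
      ultimately show False using e e2 by (simp add: algebra_simps)
    qed
    moreover have "y1 = (1 - y2 / m) * s + (y2 / m) * p"
      using e 1 s by (intro conv) simp_all
    ultimately show ?thesis using 1 assms \<open>y3 = 0\<close>
      by (intro exI[of _ "y2 / m"]) auto
  next
    case 2
    have "p * m < 0" using 2 by (intro mult_pos_neg)
    then have e2: "p * m * r \<le> 0" "p * m \<le> p * m * r"
      using mult_nonpos_nonneg[of "p * m" r] mult_left_mono_neg[of r 1 "p * m"] r(1,2) by linarith+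
    \<comment> \<open>A zero at either end would leave two nonzero entries of equal sign, but their
      product \<open>p * m * r\<close> is nonpositive.\<close>
    have "y2 = 0"
    proof (rule ccontr)
      assume "y2 \<noteq> 0"
      then consider "y1 = 0" | "y3 = 0" using y by auto
      then show False
      proof cases
        case 1
        then have "y2 * y3 > 0" using y \<open>y2 \<noteq> 0\<close> by (intro mult_neg_neg) linarith+
        then show False using 1 r(3) e2 by simp
      next
        case 2
        then have "y1 * y2 > 0" using y \<open>y2 \<noteq> 0\<close> by (intro mult_pos_pos) linarith+
        then show False using 2 r(3) e2 by simp
      qed
    qed
    then have e: "y1 * y3 = p * m * r" "y1 + y3 = p + m" "0 \<le> y1" "y3 \<le> 0" using r(3) y s by auto
    have le: "y1 \<le> p"
    proof (rule ccontr)
      assume "\<not> y1 \<le> p"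
      \<comment> \<open>The product equals \<open>p * m * (1 - r)\<close>, which is
        nonpositive.\<close>
      then have "(y1 - p) * (y1 - m) > 0" using 2 by (intro mult_pos_pos) linarith+
      moreover have "(y1 - p) * (y1 - m) = p * m - y1 * (p + m - y1)"
        by (simp add: algebra_simps)
      moreover have "p + m - y1 = y3" using e(2) by simp
      ultimately show False using e(1) e2 by simp
    qed
    \<comment> \<open>The sign of \<open>s\<close> tells which weight has the smaller modulus, and
      so which coordinate supplies the parameter.\<close>
    show ?thesis
    proof (cases "s \<ge> 0")
      case True
      have "m \<le> y3" using e(2) le by linarith
      moreover have "y1 = (1 - y3 / m) * s + (y3 / m) * p"
        using e 2 s by (intro conv) simp_all
      ultimately show ?thesis using True 2 \<open>y2 = 0\<close> e(3,4) le s
        by (intro exI[of _ "y3 / m"]) (auto simp: divide_nonpos_nonpos divide_le_eq)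
    next
      case False
      have "y3 = (1 - y1 / p) * s + (y1 / p) * m"
        using e 2 s by (intro conv) simp_all
      then show ?thesis using False 2 \<open>y2 = 0\<close> e(3,4) le s
        by (intro exI[of _ "y1 / p"]) auto
    qed
  next
    case 3
    have "p * m > 0" using 3 assms by (intro mult_neg_neg) linarith+
    then have e2: "0 \<le> p * m * r" "p * m * r \<le> p * m" using r by (auto intro: mult_left_le)
    have "y1 = 0"
    proof (rule ccontr)
      assume "y1 \<noteq> 0"
      then consider "y3 = 0" | "y2 = 0" using y by auto
      then show False
      proof cases
        case 1
        then show False using y s \<open>p < 0\<close> assms by linarith
      next
        case 2
        then have "y1 > 0" using y \<open>y1 \<noteq> 0\<close> by linarith
        moreover have "y3 < 0" using y 2 s \<open>p < 0\<close> assms by linarith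
        ultimately have "y1 * y3 < 0" by (simp add: mult_pos_neg)
        then show False using 2 r(3) e2 by simp
      qed
    qed
    then have e: "y2 * y3 = p * m * r" "y2 + y3 = p + m" using r(3) y s by auto
    have "y2 \<le> 0" using \<open>y1 = 0\<close> y by simp
    moreover have "p \<le> y2"
    proof (rule ccontr)
      assume "\<not> p \<le> y2"
      then have "(y2 - p) * (y3 - p) > 0" using y(2) by (intro mult_neg_neg) linarith+
      moreover have "(y2 - p) * (y3 - p) = y2 * y3 - p * (y2 + y3) + p * p"
        by (simp add: algebra_simps)
      ultimately show False using e e2 by (simp add: algebra_simps)
    qed
    moreover have "y3 = (1 - y2 / p) * s + (y2 / p) * m"
      using e 3 s by (intro conv) simp_all
    ultimately show ?thesis using 3 assms \<open>y1 = 0\<close>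
      by (intro exI[of _ "y2 / p"]) (auto simp: divide_nonpos_nonpos divide_le_eq)
  qed
next
  assume ?R
  then obtain t where t: "0 \<le> t" "t \<le> 1" and y: "y1 = (1 - t) * max s 0 + t * max p 0"
      "y2 = t * (max m 0 + min p 0)" "y3 = (1 - t) * min s 0 + t * min m 0" by blast
  have conv: "(1 - t) * b + t * b' \<le> (1 - t) * a + t * a'" if "b \<le> a" "b' \<le> a'" for a a' b b' :: real
    using that t by (intro add_mono mult_left_mono) auto
  have "y2 \<le> y1" "y3 \<le> y2"
    using conv[of 0 "max s 0" "max m 0 + min p 0" "max p 0"]
      conv[of "min s 0" 0 "min m 0" "max m 0 + min p 0"] assms y by (auto simp: max_def min_def)
  moreover have "y1 + y2 + y3 = s"
    unfolding y s using assms by (auto simp: max_def min_def algebra_simps)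
  moreover have "y1 * y2 * y3 = 0"
    unfolding y s using assms by (auto simp: max_def min_def)
  moreover have "\<exists>r. 0 \<le> r \<and> r \<le> 1 \<and> y1 * y2 + y1 * y3 + y2 * y3 = p * m * r"
  proof -
    \<comment> \<open>The bounds on \<open>s / k\<close>, which is \<open>1 + g / k\<close>, say
      that \<open>g\<close> has modulus at most that of \<open>k\<close>. The witness for
      \<open>r\<close> comes from writing \<open>s - t * g\<close> as
      \<open>(1 - t) * s + t * k\<close> and dividing by \<open>k\<close>.\<close>
    have ex: "\<exists>r. 0 \<le> r \<and> r \<le> 1 \<and> t * g * (s - t * g) = p * m * r"
      if gk: "g * k = p * m" "g + k = s" "k \<noteq> 0" "0 \<le> s / k" "s / k \<le> 2" for g k
    proof (intro exI conjI)
      define \<sigma> where "\<sigma> = s / k"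
      have \<sigma>: "0 \<le> \<sigma>" "\<sigma> \<le> 2" "\<sigma> * k = s" using gk by (simp_all add: \<sigma>_def)
      let ?r = "t * (t + (1 - t) * \<sigma>)"
      show "0 \<le> ?r" using t \<sigma> by simp
      have "1 - ?r = (1 - t) * ((1 - t) + t * (2 - \<sigma>))" by (simp add: algebra_simps)
      moreover have "\<dots> \<ge> 0" using t \<sigma> by simp
      ultimately show "?r \<le> 1" by linarith
      show "t * g * (s - t * g) = p * m * ?r"
        using gk(1,2) \<sigma>(3) by algebra
    qed
    consider "m > 0" | "p > 0" "m < 0" "s \<ge> 0" | "p > 0" "m < 0" "s < 0" | "p < 0"
      using assms by linarith
    then show ?thesis
    proof cases
      case 1
      then have "y1 = s - t * m" "y2 = t * m" "y3 = 0"
        using y s assms by (auto simp: algebra_simps)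
      then have "y1 * y2 + y1 * y3 + y2 * y3 = t * m * (s - t * m)" by simp
      moreover have "\<exists>r. 0 \<le> r \<and> r \<le> 1 \<and> t * m * (s - t * m) = p * m * r"
        by (rule ex[of m p]) (use 1 assms in \<open>auto simp: field_simps\<close>)
      ultimately show ?thesis by simp
    next
      case 2
      then have "y1 = s - t * m" "y2 = 0" "y3 = t * m"
        using y s assms by (auto simp: algebra_simps)
      then have "y1 * y2 + y1 * y3 + y2 * y3 = t * m * (s - t * m)" by simp
      moreover have "\<exists>r. 0 \<le> r \<and> r \<le> 1 \<and> t * m * (s - t * m) = p * m * r"
        by (rule ex[of m p]) (use 2 assms in \<open>auto simp: field_simps\<close>)
      ultimately show ?thesis by simp
    next
      case 3
      then have "y1 = t * p" "y2 = 0" "y3 = s - t * p"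
        using y s assms by (auto simp: algebra_simps)
      then have "y1 * y2 + y1 * y3 + y2 * y3 = t * p * (s - t * p)" by simp
      moreover have "\<exists>r. 0 \<le> r \<and> r \<le> 1 \<and> t * p * (s - t * p) = p * m * r"
        by (rule ex[of p m]) (use 3 assms in \<open>auto simp: field_simps\<close>)
      ultimately show ?thesis by simp
    next
      case 4
      then have "y1 = 0" "y2 = t * p" "y3 = s - t * p"
        using y s assms by (auto simp: algebra_simps)
      then have "y1 * y2 + y1 * y3 + y2 * y3 = t * p * (s - t * p)" by simp
      moreover have "\<exists>r. 0 \<le> r \<and> r \<le> 1 \<and> t * p * (s - t * p) = p * m * r"
        by (rule ex[of p m]) (use 4 assms in \<open>auto simp: field_simps\<close>)
      ultimately show ?thesis by simp
    qed
  qed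
  ultimately show ?L by blast
qed

lemma momentum_polytope_eq:
  assumes "\<Gamma>1 \<noteq> 0" "\<Gamma>2 \<noteq> 0"
  shows "momentum_polytope \<Gamma>1 \<Gamma>2 = closed_segment (polytope_a \<Gamma>1 \<Gamma>2) (polytope_c \<Gamma>1 \<Gamma>2)"
proof (intro set_eqI)
  fix x :: "real^3"
  define y :: "real^3" where "y = (\<chi> k. x $ k + (\<Gamma>1 + \<Gamma>2) / 3)"
  define p m where pm: "p = max \<Gamma>1 \<Gamma>2" "m = min \<Gamma>1 \<Gamma>2"
  have sp: "\<Gamma>1 + \<Gamma>2 = p + m" "\<Gamma>1 * \<Gamma>2 = p * m" "m \<le> p" "p \<noteq> 0" "m \<noteq> 0"
    using assms by (auto simp: pm max_def min_def)
  have "x \<in> momentum_polytope \<Gamma>1 \<Gamma>2 \<longleftrightarrow> (\<exists>t. 0 \<le> t \<and> t \<le> 1 \<and>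
      y$1 = (1 - t) * max (p + m) 0 + t * max p 0 \<and> y$2 = t * (max m 0 + min p 0) \<and>
      y$3 = (1 - t) * min (p + m) 0 + t * min m 0)"
    by (subst momentum_polytope_iff[where y = y])
      (simp add: y_def, unfold sp, rule segment_coordinates_iff[OF sp(3-5) refl])
  also have "\<dots> \<longleftrightarrow> x \<in> closed_segment (polytope_a \<Gamma>1 \<Gamma>2) (polytope_c \<Gamma>1 \<Gamma>2)"
    unfolding closed_segment_def mem_Collect_eq
    by (intro ex_cong1)
      (auto simp: vec_eq_iff forall_3 y_def polytope_a_def polytope_c_def shifted_def Let_def sp(1)
        algebra_simps simp flip: pm)
  finally show "x \<in> momentum_polytope \<Gamma>1 \<Gamma>2 \<longleftrightarrow>
    x \<in> closed_segment (polytope_a \<Gamma>1 \<Gamma>2) (polytope_c \<Gamma>1 \<Gamma>2)" .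
qed

section \<open>Spectra at the two endpoints\<close>

lemma prod_minus_shifted:
  "(\<Prod>i\<in>UNIV. t - of_real (shifted s x y z $ i)) =
    (t + of_real (s / 3) - of_real x) * (t + of_real (s / 3) - of_real y) *
    (t + of_real (s / 3) - of_real z :: complex)"
  by (simp add: prod_UNIV_3 shifted_def diff_diff_eq2)

text \<open>For coinciding lines the Gram determinant vanishes, so the eigenvalues before the shift
  are \<open>\<Gamma>1 + \<Gamma>2\<close>, 0 and 0.\<close>

lemma ordered_spectrum_momentum_same: "ordered_spectrum (momentum \<Gamma>1 \<Gamma>2 (p, p)) (polytope_a \<Gamma>1 \<Gamma>2)"
proof -
  obtain u where u: "norm u = 1" "p = proj_class u" by (rule cp2_cases)
  have "det (mat t - momentum \<Gamma>1 \<Gamma>2 (p, p)) = (\<Prod>i\<in>UNIV. t - of_real (polytope_a \<Gamma>1 \<Gamma>2 $ i))" for t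
  proof -
    define \<tau> where "\<tau> = t + of_real ((\<Gamma>1 + \<Gamma>2) / 3)"
    have max_min: "max (\<Gamma>1 + \<Gamma>2) 0 + min (\<Gamma>1 + \<Gamma>2) 0 = \<Gamma>1 + \<Gamma>2"
      "max (\<Gamma>1 + \<Gamma>2) 0 * min (\<Gamma>1 + \<Gamma>2) 0 = 0" by (auto simp: max_def min_def)
    have "det (mat t - momentum \<Gamma>1 \<Gamma>2 (p, p)) = \<tau> * (\<tau>\<^sup>2 - of_real (\<Gamma>1 + \<Gamma>2) * \<tau>)"
      unfolding u(2) det_momentum[OF u(1) u(1) \<tau>_def] by (simp add: u(1) norm_hprod)
    also have "\<dots> = (\<tau> - of_real (max (\<Gamma>1 + \<Gamma>2) 0)) * (\<tau> - of_real 0) * (\<tau> - of_real (min (\<Gamma>1 + \<Gamma>2) 0))"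
      using arg_cong[OF max_min(1), of complex_of_real] arg_cong[OF max_min(2), of complex_of_real]
      unfolding of_real_add of_real_mult of_real_0 by algebra
    finally show ?thesis
      by (simp add: polytope_a_def Let_def prod_minus_shifted \<tau>_def)
  qed
  moreover have "polytope_a \<Gamma>1 \<Gamma>2 $ 1 \<ge> polytope_a \<Gamma>1 \<Gamma>2 $ 2" "polytope_a \<Gamma>1 \<Gamma>2 $ 2 \<ge> polytope_a \<Gamma>1 \<Gamma>2 $ 3"
    by (auto simp: polytope_a_def shifted_def Let_def)
  ultimately show ?thesis unfolding ordered_spectrum_def by blast
qed

text \<open>For orthogonal lines the Gram determinant is 1, so the eigenvalues before the shift are
  \<open>\<Gamma>1\<close>, \<open>\<Gamma>2\<close> and 0.\<close>

lemma ordered_spectrum_momentum_orthogonal: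
  assumes "orthogonal_lines p q"
  shows "ordered_spectrum (momentum \<Gamma>1 \<Gamma>2 (p, q)) (polytope_c \<Gamma>1 \<Gamma>2)"
proof -
  obtain u v where uv: "norm u = 1" "p = proj_class u" "norm v = 1" "q = proj_class v"
    using cp2_cases by metis
  have ort: "hprod u v = 0" using assms orthogonal_lines_proj_class uv by simp
  define x where "x = max (max \<Gamma>1 \<Gamma>2) 0"
  define y where "y = max (min \<Gamma>1 \<Gamma>2) 0 + min (max \<Gamma>1 \<Gamma>2) 0"
  define z where "z = min (min \<Gamma>1 \<Gamma>2) 0"
  have "det (mat t - momentum \<Gamma>1 \<Gamma>2 (p, q)) = (\<Prod>i\<in>UNIV. t - of_real (polytope_c \<Gamma>1 \<Gamma>2 $ i))" for t
  proof -
    define \<tau> where "\<tau> = t + of_real ((\<Gamma>1 + \<Gamma>2) / 3)"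
    \<comment> \<open>Sorting does not change elementary symmetric functions, so no case split is
      needed when factoring the polynomial.\<close>
    have sym: "x + y + z = \<Gamma>1 + \<Gamma>2" "x * y + x * z + y * z = \<Gamma>1 * \<Gamma>2" "x * y * z = 0"
      unfolding x_def y_def z_def by (auto simp: max_def min_def)
    have "det (mat t - momentum \<Gamma>1 \<Gamma>2 (p, q)) =
        \<tau> * (\<tau>\<^sup>2 - of_real (\<Gamma>1 + \<Gamma>2) * \<tau> + of_real (\<Gamma>1 * \<Gamma>2))"
      unfolding uv(2,4) det_momentum[OF uv(1) uv(3) \<tau>_def] by (simp add: ort)
    also have "\<dots> = (\<tau> - of_real x) * (\<tau> - of_real y) * (\<tau> - of_real z)"
      using sym[THEN arg_cong[where f = complex_of_real]]
      unfolding of_real_add of_real_mult of_real_0 by algebra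
    finally show ?thesis
      by (simp add: polytope_c_def Let_def prod_minus_shifted \<tau>_def x_def y_def z_def)
  qed
  moreover have "polytope_c \<Gamma>1 \<Gamma>2 $ 1 \<ge> polytope_c \<Gamma>1 \<Gamma>2 $ 2" "polytope_c \<Gamma>1 \<Gamma>2 $ 2 \<ge> polytope_c \<Gamma>1 \<Gamma>2 $ 3"
    by (auto simp: polytope_c_def shifted_def Let_def)
  ultimately show ?thesis unfolding ordered_spectrum_def by blast
qed

section \<open>Types of weights and their separation by the polytope\<close>

lemma of_type_max_min: "of_type \<tau> (max \<Gamma>1 \<Gamma>2) (min \<Gamma>1 \<Gamma>2) \<longleftrightarrow> of_type \<tau> \<Gamma>1 \<Gamma>2"
  by (cases \<tau>) (auto simp: max_def min_def)

lemma of_type_unique: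
  "of_type \<tau> \<Gamma>1 \<Gamma>2 \<Longrightarrow> of_type \<tau>' \<Gamma>1 \<Gamma>2 \<Longrightarrow> \<Gamma>1 \<noteq> 0 \<Longrightarrow> \<Gamma>2 \<noteq> 0 \<Longrightarrow> \<tau> = \<tau>'"
  by (cases \<tau>; cases \<tau>') (auto simp: max_def min_def split: if_splits)

lemma of_type_exists:
  assumes "\<Gamma>1 \<noteq> 0" "\<Gamma>2 \<noteq> 0"
  shows "\<exists>\<tau>. of_type \<tau> \<Gamma>1 \<Gamma>2"
proof -
  consider "of_type Type_a \<Gamma>1 \<Gamma>2" | "of_type Type_b \<Gamma>1 \<Gamma>2" | "of_type Type_c \<Gamma>1 \<Gamma>2"
    | "of_type Type_d \<Gamma>1 \<Gamma>2" | "of_type Type_e \<Gamma>1 \<Gamma>2" | "of_type Type_f \<Gamma>1 \<Gamma>2"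
    | "of_type Type_g \<Gamma>1 \<Gamma>2"
    using assms unfolding of_type.simps max_def min_def by (smt (verit))
  then show ?thesis by cases blast+
qed

text \<open>A segment determines its endpoints up to exchange. If they match in order, the first
  gives the sum of the weights and the second then gives the sorted weights. An exchange is
  impossible: \<open>polytope_c\<close> would lie on a wall, which forces equal weights, and the
  other \<open>polytope_c\<close> would then have no zero entry after undoing its shift.\<close>

lemma momentum_polytope_determines_weights:
  assumes "\<Gamma>1 \<noteq> 0" "\<Gamma>2 \<noteq> 0" "\<Gamma>1' \<noteq> 0" "\<Gamma>2' \<noteq> 0"
    and "momentum_polytope \<Gamma>1' \<Gamma>2' = momentum_polytope \<Gamma>1 \<Gamma>2"
  shows "max \<Gamma>1' \<Gamma>2' = max \<Gamma>1 \<Gamma>2 \<and> min \<Gamma>1' \<Gamma>2' = min \<Gamma>1 \<Gamma>2"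
proof -
  define p m p' m' where pm: "p = max \<Gamma>1 \<Gamma>2" "m = min \<Gamma>1 \<Gamma>2" "p' = max \<Gamma>1' \<Gamma>2'" "m' = min \<Gamma>1' \<Gamma>2'"
  have nz: "m \<le> p" "p \<noteq> 0" "m \<noteq> 0" "\<Gamma>1 + \<Gamma>2 = p + m"
    "m' \<le> p'" "p' \<noteq> 0" "m' \<noteq> 0" "\<Gamma>1' + \<Gamma>2' = p' + m'"
    using assms(1-4) by (auto simp: pm max_def min_def)
  have "{polytope_a \<Gamma>1' \<Gamma>2', polytope_c \<Gamma>1' \<Gamma>2'} = {polytope_a \<Gamma>1 \<Gamma>2, polytope_c \<Gamma>1 \<Gamma>2}"
    using assms(5) unfolding momentum_polytope_eq[OF assms(1,2)] momentum_polytope_eq[OF assms(3,4)]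
    by simp
  then consider "polytope_a \<Gamma>1' \<Gamma>2' = polytope_a \<Gamma>1 \<Gamma>2" "polytope_c \<Gamma>1' \<Gamma>2' = polytope_c \<Gamma>1 \<Gamma>2"
    | "polytope_a \<Gamma>1' \<Gamma>2' = polytope_c \<Gamma>1 \<Gamma>2" "polytope_c \<Gamma>1' \<Gamma>2' = polytope_a \<Gamma>1 \<Gamma>2"
    by (auto simp: doubleton_eq_iff)
  then have "p' = p \<and> m' = m"
    by cases
      (use nz in \<open>simp_all add: polytope_a_def polytope_c_def shifted_def Let_def vec_eq_iff forall_3
        flip: pm\<close>, (smt (verit) max_def min_def)+)
  then show ?thesis by (simp add: pm)
qed

text \<open>The interior is relative to the plane \<open>cartan_dual\<close>: strict inequalities
  are open in the ambient space, and their trace on the plane lies in the chamber.\<close>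

lemma weyl_interiorI:
  assumes "x \<in> cartan_dual" "x $ 1 > x $ 2" "x $ 2 > x $ 3"
  shows "x \<in> weyl_interior"
proof -
  define U where "U = {x :: real^3. x $ 1 > x $ 2} \<inter> {x. x $ 2 > x $ 3}"
  have "open U"
    unfolding U_def by (intro open_Int open_Collect_less continuous_intros)
  then have "openin (top_of_set cartan_dual) (cartan_dual \<inter> U)" by blast
  moreover have "cartan_dual \<inter> U \<subseteq> weyl_chamber" by (auto simp: U_def weyl_chamber_def)
  ultimately show ?thesis
    unfolding weyl_interior_def interior_of_def using assms by (auto simp: U_def)
qed

theorem theorem3p1:
  fixes \<Gamma>1 \<Gamma>2 s \<Gamma>p \<Gamma>m :: real
  assumes "\<Gamma>1 \<noteq> 0" and "\<Gamma>2 \<noteq> 0"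
    and "s = \<Gamma>1 + \<Gamma>2" and "\<Gamma>p = max \<Gamma>1 \<Gamma>2" and "\<Gamma>m = min \<Gamma>1 \<Gamma>2"
  shows "\<exists>a c.
    momentum_polytope \<Gamma>1 \<Gamma>2 = closed_segment a c \<and> a \<noteq> c \<and>
    (\<forall>u. ordered_spectrum (momentum \<Gamma>1 \<Gamma>2 (u, u)) a) \<and>
    (\<forall>u v. orthogonal_lines u v \<longrightarrow> ordered_spectrum (momentum \<Gamma>1 \<Gamma>2 (u, v)) c) \<and>
    (\<exists>!\<tau>. of_type \<tau> \<Gamma>1 \<Gamma>2) \<and>
    (\<forall>\<tau>. of_type \<tau> \<Gamma>1 \<Gamma>2 \<longrightarrow>
      (\<tau> \<in> generic_types \<longleftrightarrow> \<Gamma>1 \<noteq> \<Gamma>2 \<and> \<Gamma>1 \<noteq> - \<Gamma>2) \<and>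
      (\<tau> \<in> transitional_types \<longleftrightarrow> \<Gamma>1 = \<Gamma>2 \<or> \<Gamma>1 = - \<Gamma>2) \<and>
      (\<tau> \<in> generic_types \<longrightarrow>
        a \<in> wall12 \<union> wall23 \<and> a \<noteq> 0 \<and> c \<in> weyl_interior) \<and>
      (\<forall>\<Gamma>1' \<Gamma>2' \<tau>'. \<Gamma>1' \<noteq> 0 \<and> \<Gamma>2' \<noteq> 0 \<and> of_type \<tau>' \<Gamma>1' \<Gamma>2' \<and> \<tau>' \<noteq> \<tau> \<longrightarrow>
        momentum_polytope \<Gamma>1' \<Gamma>2' \<noteq> momentum_polytope \<Gamma>1 \<Gamma>2)) \<and>
    (of_type Type_a \<Gamma>1 \<Gamma>2 \<longrightarrow>
      a = shifted s s 0 0 \<and> a \<in> wall23 \<and> c = shifted s \<Gamma>p \<Gamma>m 0) \<and>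
    (of_type Type_b \<Gamma>1 \<Gamma>2 \<longrightarrow>
      a = shifted s s 0 0 \<and> a \<in> wall23 \<and> c = shifted s \<Gamma>p 0 \<Gamma>m) \<and>
    (of_type Type_c \<Gamma>1 \<Gamma>2 \<longrightarrow>
      a = shifted s 0 0 s \<and> a \<in> wall12 \<and> c = shifted s \<Gamma>p 0 \<Gamma>m) \<and>
    (of_type Type_d \<Gamma>1 \<Gamma>2 \<longrightarrow>
      a = shifted s 0 0 s \<and> a \<in> wall12 \<and> c = shifted s 0 \<Gamma>p \<Gamma>m) \<and>
    (of_type Type_e \<Gamma>1 \<Gamma>2 \<longrightarrow>
      a = shifted s s 0 0 \<and> a \<in> wall23 \<and> c = shifted s \<Gamma>1 \<Gamma>1 0 \<and> c \<in> wall12) \<and>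
    (of_type Type_f \<Gamma>1 \<Gamma>2 \<longrightarrow>
      a = 0 \<and> c = vector [\<Gamma>p, 0, \<Gamma>m] \<and> momentum_polytope \<Gamma>1 \<Gamma>2 \<subseteq> {x. x$2 = 0}) \<and>
    (of_type Type_g \<Gamma>1 \<Gamma>2 \<longrightarrow>
      a = shifted s 0 0 s \<and> a \<in> wall12 \<and> c = shifted s 0 \<Gamma>1 \<Gamma>1 \<and> c \<in> wall23)"
proof (intro exI conjI)
  let ?a = "polytope_a \<Gamma>1 \<Gamma>2" and ?c = "polytope_c \<Gamma>1 \<Gamma>2"
  note nz = assms(1,2)
  note coords = polytope_a_def polytope_c_def shifted_def Let_def wall12_def wall23_def
    weyl_chamber_def cartan_dual_def assms(3-5) add_divide_distrib
  show "momentum_polytope \<Gamma>1 \<Gamma>2 = closed_segment ?a ?c"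
    by (rule momentum_polytope_eq[OF nz])
  show "?a \<noteq> ?c"
    using nz by (auto simp: coords vec_eq_iff forall_3 max_def min_def split: if_splits)
  show "\<forall>u. ordered_spectrum (momentum \<Gamma>1 \<Gamma>2 (u, u)) ?a"
    by (simp add: ordered_spectrum_momentum_same)
  show "\<forall>u v. orthogonal_lines u v \<longrightarrow> ordered_spectrum (momentum \<Gamma>1 \<Gamma>2 (u, v)) ?c"
    by (simp add: ordered_spectrum_momentum_orthogonal)
  show "\<exists>!\<tau>. of_type \<tau> \<Gamma>1 \<Gamma>2"
    using of_type_exists of_type_unique nz by metis
  show "\<forall>\<tau>. of_type \<tau> \<Gamma>1 \<Gamma>2 \<longrightarrow>
      (\<tau> \<in> generic_types \<longleftrightarrow> \<Gamma>1 \<noteq> \<Gamma>2 \<and> \<Gamma>1 \<noteq> - \<Gamma>2) \<and>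
      (\<tau> \<in> transitional_types \<longleftrightarrow> \<Gamma>1 = \<Gamma>2 \<or> \<Gamma>1 = - \<Gamma>2) \<and>
      (\<tau> \<in> generic_types \<longrightarrow> ?a \<in> wall12 \<union> wall23 \<and> ?a \<noteq> 0 \<and> ?c \<in> weyl_interior) \<and>
      (\<forall>\<Gamma>1' \<Gamma>2' \<tau>'. \<Gamma>1' \<noteq> 0 \<and> \<Gamma>2' \<noteq> 0 \<and> of_type \<tau>' \<Gamma>1' \<Gamma>2' \<and> \<tau>' \<noteq> \<tau> \<longrightarrow>
        momentum_polytope \<Gamma>1' \<Gamma>2' \<noteq> momentum_polytope \<Gamma>1 \<Gamma>2)"
  proof (intro allI impI conjI)
    fix \<tau> assume \<tau>: "of_type \<tau> \<Gamma>1 \<Gamma>2"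
    show gen: "\<tau> \<in> generic_types \<longleftrightarrow> \<Gamma>1 \<noteq> \<Gamma>2 \<and> \<Gamma>1 \<noteq> - \<Gamma>2"
      using \<tau> nz by (cases \<tau>) (auto simp: generic_types_def)
    then show "\<tau> \<in> transitional_types \<longleftrightarrow> \<Gamma>1 = \<Gamma>2 \<or> \<Gamma>1 = - \<Gamma>2"
      by (cases \<tau>) (auto simp: generic_types_def transitional_types_def)
    {
      assume "\<tau> \<in> generic_types"
      then have ne: "\<Gamma>1 \<noteq> \<Gamma>2" "\<Gamma>1 + \<Gamma>2 \<noteq> 0" using gen by auto
      show "?a \<in> wall12 \<union> wall23"
        by (auto simp: coords max_def min_def)
      show "?a \<noteq> 0"
        using ne by (auto simp: coords vec_eq_iff forall_3 max_def min_def split: if_splits)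
      show "?c \<in> weyl_interior"
        using ne nz by (intro weyl_interiorI) (auto simp: coords max_def min_def)
    }
    fix \<Gamma>1' \<Gamma>2' \<tau>' assume *: "\<Gamma>1' \<noteq> 0 \<and> \<Gamma>2' \<noteq> 0 \<and> of_type \<tau>' \<Gamma>1' \<Gamma>2' \<and> \<tau>' \<noteq> \<tau>"
    show "momentum_polytope \<Gamma>1' \<Gamma>2' \<noteq> momentum_polytope \<Gamma>1 \<Gamma>2"
    proof
      assume "momentum_polytope \<Gamma>1' \<Gamma>2' = momentum_polytope \<Gamma>1 \<Gamma>2"
      \<comment> \<open>The polytope gives back the weights up to order, and the type is insensitive
        to that order.\<close>
      then have "of_type \<tau>' \<Gamma>1 \<Gamma>2"
        using momentum_polytope_determines_weights[OF nz, of \<Gamma>1' \<Gamma>2'] * of_type_max_min by metis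
      then show False using of_type_unique[OF \<tau> _ nz] * by blast
    qed
  qed
  show "of_type Type_f \<Gamma>1 \<Gamma>2 \<longrightarrow> ?a = 0 \<and> ?c = vector [\<Gamma>p, 0, \<Gamma>m] \<and>
      momentum_polytope \<Gamma>1 \<Gamma>2 \<subseteq> {x. x$2 = 0}"
    unfolding momentum_polytope_eq[OF nz] closed_segment_def
    using nz by (auto simp: coords vec_eq_iff forall_3 max_def min_def)
qed (use assms in \<open>auto simp: polytope_a_def polytope_c_def shifted_def Let_def wall12_def wall23_def
    weyl_chamber_def cartan_dual_def max_def min_def add_divide_distrib\<close>)

end
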